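(* Let $\tau$ be a triangle function on $\Delta^+$, let $\Sigma$ be a ring of subsets of a set $\Omega\neq\emptyset$, and let $\gamma:\Sigma\to\Delta^+$ be a mapping with $\gamma_\emptyset=\varepsilon_0$. Then $\gamma$ is a $\tau$-decomposable measure on $\Sigma$ if and only if $\tau(\gamma_{E\cup F},\gamma_{E\cap F})=\tau(\gamma_E,\gamma_F)$ for all $E,F\in\Sigma$.
   Context: $\Delta^+$ is the set of distance distribution functions: all $F:[-\infty,+\infty]\to[0,1]$ that are non-decreasing, left-continuous on $\mathbb{R}$, with $F(-\infty)=0$, $F(0)=0$ and $F(+\infty)=1$. It is ordered pointwise: $G\leq H$ iff $G(x)\leq H(x)$ for all $x$. The element $\varepsilon_0\in\Delta^+$ is given by $\varepsilon_0(x)=1$ for $x>0$ and $\varepsilon_0(x)=0$ otherwise. A triangle function is a mapping $\tau:\Delta^+\times\Delta^+\to\Delta^+$ that is symmetric, associative, non-decreasing in each variable, and has $\varepsilon_0$ as identity. For $\gamma:\Sigma\to\Delta^+$ write $\gamma_E$ for $\gamma(E)$. A mapping $\gamma:\Sigma\to\Delta^+$ is a $\tau$-decomposable measure if $\gamma_\emptyset=\varepsilon_0$ and $\gamma_{E\cup F}=\tau(\gamma_E,\gamma_F)$ for all disjoint $E,F\in\Sigma$. *)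

theory Defs
  imports "HOL-Analysis.Analysis"
begin

text \<open>
  Distance distribution functions are total functions on the extended reals, so equality of
  functions is equality in \<open>\<Delta>\<^sup>+\<close>, and the pointwise order is the order \<open>\<le>\<close> of the function type.
\<close>

definition distance_dfs :: "(ereal \<Rightarrow> real) set" where
  "distance_dfs = {F. range F \<subseteq> {0..1} \<and> mono F \<and>
     (\<forall>x::real. continuous (at_left (ereal x)) F) \<and>
     F (-\<infinity>) = 0 \<and> F 0 = 0 \<and> F \<infinity> = 1}"

definition eps0 :: "ereal \<Rightarrow> real" where
  "eps0 x = (if x > 0 then 1 else 0)"

text \<open>
  A triangle function is a total function of the ambient type; only its values on
  \<open>\<Delta>\<^sup>+\<close> are constrained.
\<close>

locale triangle_function =
  fixes \<tau> :: "(ereal \<Rightarrow> real) \<Rightarrow> (ereal \<Rightarrow> real) \<Rightarrow> (ereal \<Rightarrow> real)"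
  assumes closed: "\<tau> \<in> distance_dfs \<rightarrow> distance_dfs \<rightarrow> distance_dfs"
    and symmetric: "\<lbrakk>F \<in> distance_dfs; G \<in> distance_dfs\<rbrakk> \<Longrightarrow> \<tau> F G = \<tau> G F"
    and associative: "\<lbrakk>F \<in> distance_dfs; G \<in> distance_dfs; H \<in> distance_dfs\<rbrakk>
      \<Longrightarrow> \<tau> (\<tau> F G) H = \<tau> F (\<tau> G H)"
    and mono_left: "G \<in> distance_dfs \<Longrightarrow> mono_on distance_dfs (\<lambda>F. \<tau> F G)"
    and mono_right: "F \<in> distance_dfs \<Longrightarrow> mono_on distance_dfs (\<lambda>G. \<tau> F G)"
    and identity_left: "F \<in> distance_dfs \<Longrightarrow> \<tau> eps0 F = F"
    and identity_right: "F \<in> distance_dfs \<Longrightarrow> \<tau> F eps0 = F"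

definition decomposable_measure ::
  "((ereal \<Rightarrow> real) \<Rightarrow> (ereal \<Rightarrow> real) \<Rightarrow> (ereal \<Rightarrow> real)) \<Rightarrow> 'a set set \<Rightarrow>
   ('a set \<Rightarrow> ereal \<Rightarrow> real) \<Rightarrow> bool" where
  "decomposable_measure \<tau> M \<gamma> \<longleftrightarrow>
     \<gamma> \<in> M \<rightarrow> distance_dfs \<and> \<gamma> {} = eps0 \<and>
     (\<forall>E\<in>M. \<forall>F\<in>M. E \<inter> F = {} \<longrightarrow> \<gamma> (E \<union> F) = \<tau> (\<gamma> E) (\<gamma> F))"

lemma eps0_in_distance_dfs: "eps0 \<in> distance_dfs"
proof -
  have "continuous (at_left (ereal x)) eps0" for x :: real
  proof -
    have ev: "\<forall>\<^sub>F y in at_left (ereal x). eps0 y = eps0 (ereal x)"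
    proof (cases "x > 0")
      case True
      then have "\<forall>\<^sub>F y in at_left (ereal x). y \<in> {0<..<ereal x}"
        by (intro eventually_at_leftI[of 0]) auto
      then show ?thesis
        by (rule eventually_mono) (use True in \<open>auto simp: eps0_def\<close>)
    next
      case False
      have "\<forall>\<^sub>F y in at_left (ereal x). y < ereal x"
        by (simp add: eventually_at_filter)
      then show ?thesis
      proof (rule eventually_mono)
        fix y :: ereal assume y: "y < ereal x"
        have x: "ereal x \<le> 0" using False by simp
        have "y \<le> 0" using less_imp_le[OF y] x by (rule order_trans)
        then show "eps0 y = eps0 (ereal x)" using x by (simp add: eps0_def not_less[symmetric])
      qed
    qed
    then have "(eps0 \<longlongrightarrow> eps0 (ereal x)) (at_left (ereal x))"
      by (rule tendsto_eventually)
    then show ?thesis by (simp add: continuous_within)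
  qed
  moreover have "mono eps0"
    by (rule monoI) (auto simp: eps0_def)
  ultimately show ?thesis
    by (auto simp: distance_dfs_def eps0_def)
qed

end

theory Submission
  imports Defs
begin

text \<open>Both directions are monoid algebra: \<open>\<tau>\<close> is an associative operation on
  \<open>distance_dfs\<close> with identity \<open>eps0\<close>. If \<gamma> is decomposable, the
  disjoint splittings of E \<union> F into E and F - E, and of F into F - E and E \<inter> F, turn
  the two sides of the identity into two bracketings of the same product of three values.
  Conversely, for disjoint E and F the factor \<gamma> (E \<inter> F) is \<open>eps0\<close>, and
  the identity collapses to decomposability.\<close>

theorem theorem4p1:
  fixes \<tau> :: "(ereal \<Rightarrow> real) \<Rightarrow> (ereal \<Rightarrow> real) \<Rightarrow> (ereal \<Rightarrow> real)"
    and \<Omega> :: "'a set"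
    and M :: "'a set set"
    and \<gamma> :: "'a set \<Rightarrow> ereal \<Rightarrow> real"
  assumes "triangle_function \<tau>"
    and "\<Omega> \<noteq> {}"
    and "ring_of_sets \<Omega> M"
    and "\<gamma> \<in> M \<rightarrow> distance_dfs"
    and "\<gamma> {} = eps0"
  shows "decomposable_measure \<tau> M \<gamma> \<longleftrightarrow>
    (\<forall>E\<in>M. \<forall>F\<in>M. \<tau> (\<gamma> (E \<union> F)) (\<gamma> (E \<inter> F)) = \<tau> (\<gamma> E) (\<gamma> F))"
proof -
  interpret triangle_function \<tau> by fact
  interpret ring_of_sets \<Omega> M by fact
  have \<gamma>: "\<gamma> E \<in> distance_dfs" if "E \<in> M" for E
    using assms(4) that by blast
  show ?thesis
  proof
    assume "decomposable_measure \<tau> M \<gamma>"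
    then have add: "\<gamma> (E \<union> F) = \<tau> (\<gamma> E) (\<gamma> F)"
      if "E \<in> M" "F \<in> M" "E \<inter> F = {}" for E F
      using that by (simp add: decomposable_measure_def)
    show "\<forall>E\<in>M. \<forall>F\<in>M. \<tau> (\<gamma> (E \<union> F)) (\<gamma> (E \<inter> F)) = \<tau> (\<gamma> E) (\<gamma> F)"
    proof (intro ballI)
      fix E F assume E: "E \<in> M" and F: "F \<in> M"
      have D: "F - E \<in> M" and I: "E \<inter> F \<in> M"
        using E F by auto
      have "\<tau> (\<gamma> (E \<union> F)) (\<gamma> (E \<inter> F)) = \<tau> (\<tau> (\<gamma> E) (\<gamma> (F - E))) (\<gamma> (E \<inter> F))"
        using add[of E "F - E"] E D by simp
      \<comment> \<open>Regrouping brings together the values of F - E and E \<inter> F, the two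
        disjoint pieces of F.\<close>
      also have "\<dots> = \<tau> (\<gamma> E) (\<tau> (\<gamma> (F - E)) (\<gamma> (E \<inter> F)))"
        using E D I by (intro associative \<gamma>)
      also have "\<tau> (\<gamma> (F - E)) (\<gamma> (E \<inter> F)) = \<gamma> ((F - E) \<union> (E \<inter> F))"
        using D I by (intro add[symmetric]) auto
      also have "(F - E) \<union> (E \<inter> F) = F"
        by blast
      finally show "\<tau> (\<gamma> (E \<union> F)) (\<gamma> (E \<inter> F)) = \<tau> (\<gamma> E) (\<gamma> F)" .
    qed
  next
    assume modular: "\<forall>E\<in>M. \<forall>F\<in>M. \<tau> (\<gamma> (E \<union> F)) (\<gamma> (E \<inter> F)) = \<tau> (\<gamma> E) (\<gamma> F)"
    have "\<gamma> (E \<union> F) = \<tau> (\<gamma> E) (\<gamma> F)" if "E \<in> M" "F \<in> M" "E \<inter> F = {}" for E F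
    proof -
      \<comment> \<open>Disjointness makes the second factor \<open>eps0\<close>. The identity law
        holds only on \<open>distance_dfs\<close>, so \<open>Un\<close> is needed to place E
        \<union> F in M.\<close>
      have "\<gamma> (E \<union> F) = \<tau> (\<gamma> (E \<union> F)) (\<gamma> (E \<inter> F))"
        using that by (simp add: \<gamma> Un identity_right \<open>\<gamma> {} = eps0\<close>)
      also have "\<dots> = \<tau> (\<gamma> E) (\<gamma> F)"
        using modular that by blast
      finally show ?thesis .
    qed
    then show "decomposable_measure \<tau> M \<gamma>"
      using assms(4,5) by (simp add: decomposable_measure_def)
  qed
qed

end
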